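(* Let $\Gamma$ be an environment, $t$ a term of the simply typed $\lambda$-calculus and $A$ a simple type such that $\Gamma \vdash t : A$ is derivable. Then $\mathrm{ver}_A(t^{\Gamma}) \twoheadrightarrow \star$ in the metacalculus $\lambda^{\to}_{\mathfrak m}$.
   Context: Simple types: $A,B ::= \mathbf{a} \mid A \Rightarrow B$, where $\mathbf{a}$ ranges over a denumerable set of atomic types. Terms: $t ::= x \mid \lambda x.t \mid t\,s$. An environment $\Gamma$ is a finite set $\{x_1:A_1,\dots,x_n:A_n\}$ of assignments to distinct variables. Typing is given by the usual rules: $\Gamma, x:A \vdash x:A$; from $\Gamma,x:A \vdash t:B$ infer $\Gamma \vdash \lambda x.t : A \Rightarrow B$; from $\Gamma\vdash t:A\Rightarrow B$ and $\Gamma \vdash s:A$ infer $\Gamma\vdash t\,s:B$. The metacalculus $\lambda^{\to}_{\mathfrak m}$ has metaterms $M,N ::= x \mid \lambda x.M \mid M\,N \mid \star \mid (M \triangleright N) \mid \mathrm{gen}_{\mathbf{a}} \mid \mathrm{ver}_{\mathbf{a}}(M)$ for atomic types $\mathbf{a}$ (here $\star$ is a constant, "success", and $(M\triangleright N)$ is the guard). Terms of the simply typed $\lambda$-calculus are identified with metaterms built only from variables, abstractions and applications. For arbitrary types, generators and verifiers are defined by induction: $\mathrm{gen}_{A\Rightarrow B} := \lambda x.(\mathrm{ver}_A(x) \triangleright \mathrm{gen}_B)$ (with $x$ fresh) and $\mathrm{ver}_{A \Rightarrow B}(M) := \mathrm{ver}_B(M\,\mathrm{gen}_A)$. The reduction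 relation $\to$ is the closure under arbitrary contexts of the rules $(\lambda x.M)\,N \to M\{x:=N\}$ (capture-avoiding substitution), $(\star \triangleright M) \to M$, and $\mathrm{ver}_{\mathbf{a}}(\mathrm{gen}_{\mathbf{a}}) \to \star$; $\twoheadrightarrow$ is its reflexive-transitive closure. For an environment $\Gamma$, $M^{\Gamma}$ denotes the metaterm obtained from $M$ by replacing (capture-avoidingly) every free occurrence of each variable $x$ with $x:A \in \Gamma$ by $\mathrm{gen}_A$, leaving other variables unchanged. *)

theory Defs
  imports Main
begin

text \<open>
  Terms and metaterms are represented with de Bruijn indices, so that equality is
  \<open>\<alpha>\<close>-equivalence. Under \<open>k\<close> binders, index \<open>k + i\<close> is the \<open>i\<close>-th free variable.
\<close>

type_synonym atom = nat

datatype ty = Atom atom | Fun ty ty  (infixr "\<rightarrow>\<^sub>t" 65)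

datatype trm = Var nat | Lam trm | App trm trm

text \<open>
  Environments are finite partial maps from the free variables to types. Finiteness of the
  domain is not part of the type; it is preserved by \<open>ext\<close>.
\<close>

type_synonym env = "nat \<rightharpoonup> ty"

definition ext :: "ty \<Rightarrow> env \<Rightarrow> env" where
  "ext A \<Gamma> = (\<lambda>i. case i of 0 \<Rightarrow> Some A | Suc j \<Rightarrow> \<Gamma> j)"

inductive typing :: "env \<Rightarrow> trm \<Rightarrow> ty \<Rightarrow> bool"  ("_ \<turnstile> _ : _" [50, 50, 50] 50) where
  ty_Var: "\<Gamma> i = Some A \<Longrightarrow> \<Gamma> \<turnstile> Var i : A"
| ty_Lam: "ext A \<Gamma> \<turnstile> t : B \<Longrightarrow> \<Gamma> \<turnstile> Lam t : A \<rightarrow>\<^sub>t B"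
| ty_App: "\<Gamma> \<turnstile> t : A \<rightarrow>\<^sub>t B \<Longrightarrow> \<Gamma> \<turnstile> s : A \<Longrightarrow> \<Gamma> \<turnstile> App t s : B"

datatype mtrm =
    MVar nat
  | MLam mtrm
  | MApp mtrm mtrm
  | Star
  | Guard mtrm mtrm
  | GenA atom
  | VerA atom mtrm

primrec meta :: "trm \<Rightarrow> mtrm" where
  "meta (Var i) = MVar i"
| "meta (Lam t) = MLam (meta t)"
| "meta (App t s) = MApp (meta t) (meta s)"

text \<open>\<open>lift k M\<close> increments the indices \<open>\<ge> k\<close> of \<open>M\<close>, making room for one new binder.\<close>

primrec lift :: "nat \<Rightarrow> mtrm \<Rightarrow> mtrm" where
  "lift k (MVar i) = MVar (if i < k then i else Suc i)"
| "lift k (MLam M) = MLam (lift (Suc k) M)"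
| "lift k (MApp M N) = MApp (lift k M) (lift k N)"
| "lift k Star = Star"
| "lift k (Guard M N) = Guard (lift k M) (lift k N)"
| "lift k (GenA a) = GenA a"
| "lift k (VerA a M) = VerA a (lift k M)"

text \<open>Capture-avoiding simultaneous substitution of \<open>\<sigma> i\<close> for every free variable \<open>i\<close>.\<close>

definition up :: "(nat \<Rightarrow> mtrm) \<Rightarrow> nat \<Rightarrow> mtrm" where
  "up \<sigma> = (\<lambda>i. case i of 0 \<Rightarrow> MVar 0 | Suc j \<Rightarrow> lift 0 (\<sigma> j))"

primrec msubst :: "(nat \<Rightarrow> mtrm) \<Rightarrow> mtrm \<Rightarrow> mtrm" where
  "msubst \<sigma> (MVar i) = \<sigma> i"
| "msubst \<sigma> (MLam M) = MLam (msubst (up \<sigma>) M)"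
| "msubst \<sigma> (MApp M N) = MApp (msubst \<sigma> M) (msubst \<sigma> N)"
| "msubst \<sigma> Star = Star"
| "msubst \<sigma> (Guard M N) = Guard (msubst \<sigma> M) (msubst \<sigma> N)"
| "msubst \<sigma> (GenA a) = GenA a"
| "msubst \<sigma> (VerA a M) = VerA a (msubst \<sigma> M)"

text \<open>
  \<open>subst0 N M\<close> is \<open>M{x := N}\<close> for the body \<open>M\<close> of an abstraction \<open>\<lambda>x. M\<close>: index \<open>0\<close> is
  replaced and the remaining indices drop by one because the binder disappears.
\<close>

definition subst0 :: "mtrm \<Rightarrow> mtrm \<Rightarrow> mtrm" where
  "subst0 N = msubst (\<lambda>i. case i of 0 \<Rightarrow> N | Suc j \<Rightarrow> MVar j)"

text \<open>
  In \<open>gen (A \<rightarrow>\<^sub>t B)\<close> the metaterm \<open>gen B\<close> is placed under a binder without lifting; this is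
  correct because generators are closed, see \<open>lift_gen\<close> below.
\<close>

fun gen :: "ty \<Rightarrow> mtrm" and ver :: "ty \<Rightarrow> mtrm \<Rightarrow> mtrm" where
  "gen (Atom a) = GenA a"
| "gen (A \<rightarrow>\<^sub>t B) = MLam (Guard (ver A (MVar 0)) (gen B))"
| "ver (Atom a) M = VerA a M"
| "ver (A \<rightarrow>\<^sub>t B) M = ver B (MApp M (gen A))"

lemma lift_gen: "lift k (gen A) = gen A"
  and lift_ver: "lift k (ver A M) = ver A (lift k M)"
  by (induction A and A M arbitrary: k and k rule: gen_ver.induct) auto

inductive red :: "mtrm \<Rightarrow> mtrm \<Rightarrow> bool"  (infix "\<rightarrow>\<^sub>m" 50) where
  red_beta: "MApp (MLam M) N \<rightarrow>\<^sub>m subst0 N M"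
| red_guard: "Guard Star M \<rightarrow>\<^sub>m M"
| red_ver: "VerA a (GenA a) \<rightarrow>\<^sub>m Star"
| red_Lam: "M \<rightarrow>\<^sub>m M' \<Longrightarrow> MLam M \<rightarrow>\<^sub>m MLam M'"
| red_AppL: "M \<rightarrow>\<^sub>m M' \<Longrightarrow> MApp M N \<rightarrow>\<^sub>m MApp M' N"
| red_AppR: "N \<rightarrow>\<^sub>m N' \<Longrightarrow> MApp M N \<rightarrow>\<^sub>m MApp M N'"
| red_GuardL: "M \<rightarrow>\<^sub>m M' \<Longrightarrow> Guard M N \<rightarrow>\<^sub>m Guard M' N"
| red_GuardR: "N \<rightarrow>\<^sub>m N' \<Longrightarrow> Guard M N \<rightarrow>\<^sub>m Guard M N'"
| red_VerA: "M \<rightarrow>\<^sub>m M' \<Longrightarrow> VerA a M \<rightarrow>\<^sub>m VerA a M'"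

abbreviation reds :: "mtrm \<Rightarrow> mtrm \<Rightarrow> bool"  (infix "\<rightarrow>\<^sub>m\<^sup>*" 50) where
  "M \<rightarrow>\<^sub>m\<^sup>* N \<equiv> red\<^sup>*\<^sup>* M N"

definition env_inst :: "mtrm \<Rightarrow> env \<Rightarrow> mtrm" where
  "env_inst M \<Gamma> = msubst (\<lambda>i. case \<Gamma> i of None \<Rightarrow> MVar i | Some A \<Rightarrow> gen A) M"

end

theory Submission
  imports Defs
begin

text \<open>
  Logical relations, with \<open>M\<close> related at an atomic type \<open>a\<close> iff it reduces to \<open>gen\<^sub>a\<close>. The
  relation is closed under expansion, contains the generator of each type, and the verifier of a
  type succeeds on every related metaterm; the last two facts are proved together, by induction
  on the type. Hence \<open>t\<^sup>\<Gamma>\<close> is a substitution instance of \<open>t\<close> by related metaterms, so it is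
  itself related and its verifier succeeds.
\<close>

lemma lift_lift: "i \<le> k \<Longrightarrow> lift (Suc k) (lift i M) = lift i (lift k M)"
  by (induction M arbitrary: i k) auto

lemma msubst_lift: "msubst \<sigma> (lift k M) = msubst (\<lambda>i. \<sigma> (if i < k then i else Suc i)) M"
proof (induction M arbitrary: \<sigma> k)
  case (MLam M)
  have "(\<lambda>i. up \<sigma> (if i < Suc k then i else Suc i)) = up (\<lambda>i. \<sigma> (if i < k then i else Suc i))"
    by (auto simp: up_def fun_eq_iff split: nat.split)
  then show ?case by (simp add: MLam)
qed auto

lemma lift_msubst: "lift k (msubst \<sigma> M) = msubst (\<lambda>i. lift k (\<sigma> i)) M"
proof (induction M arbitrary: \<sigma> k)
  case (MLam M)
  have "(\<lambda>i. lift (Suc k) (up \<sigma> i)) = up (\<lambda>i. lift k (\<sigma> i))"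
    by (auto simp: up_def fun_eq_iff lift_lift split: nat.split)
  then show ?case by (simp add: MLam)
qed auto

lemma msubst_msubst: "msubst \<tau> (msubst \<sigma> M) = msubst (\<lambda>i. msubst \<tau> (\<sigma> i)) M"
proof (induction M arbitrary: \<sigma> \<tau>)
  case (MLam M)
  have "(\<lambda>i. msubst (up \<tau>) (up \<sigma> i)) = up (\<lambda>i. msubst \<tau> (\<sigma> i))"
    by (auto simp: up_def fun_eq_iff msubst_lift lift_msubst split: nat.split)
  then show ?case by (simp add: MLam)
qed auto

lemma msubst_MVar: "msubst MVar M = M"
proof (induction M)
  case (MLam M)
  have "up MVar = MVar"
    by (auto simp: up_def fun_eq_iff split: nat.split)
  then show ?case by (simp add: MLam)
qed auto

text \<open>Serves the abstraction case of \<open>rel_msubst\<close>: contracting a beta-redex whose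
  function is an instantiated abstraction gives another instance of the body.\<close>

lemma subst0_msubst_up: "subst0 N (msubst (up \<sigma>) M) = msubst (case_nat N \<sigma>) M"
proof -
  \<comment> \<open>At \<open>Suc j\<close>, the substitution behind \<open>subst0 N\<close> undoes
    the lift added by \<open>up\<close>, leaving the identity substitution on
    \<open>\<sigma> j\<close>.\<close>
  have "(\<lambda>i. msubst (case_nat N MVar) (up \<sigma> i)) = case_nat N \<sigma>"
    by (auto simp: up_def fun_eq_iff msubst_lift msubst_MVar split: nat.split)
  then show ?thesis by (simp add: subst0_def msubst_msubst)
qed

lemma msubst_gen: "msubst \<sigma> (gen A) = gen A"
  and msubst_ver: "msubst \<sigma> (ver A M) = ver A (msubst \<sigma> M)"
  by (induction A and A M arbitrary: \<sigma> and \<sigma> rule: gen_ver.induct) (auto simp: up_def)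

primrec rel :: "ty \<Rightarrow> mtrm \<Rightarrow> bool" where
  "rel (Atom a) M \<longleftrightarrow> M \<rightarrow>\<^sub>m\<^sup>* GenA a"
| "rel (A \<rightarrow>\<^sub>t B) M \<longleftrightarrow> (\<forall>N. rel A N \<longrightarrow> rel B (MApp M N))"

text \<open>At a function type, a step of \<open>M\<close> is also a step of
  \<open>MApp M N\<close>, so expansion is inherited from the result type.\<close>

lemma rel_expand: "M \<rightarrow>\<^sub>m M' \<Longrightarrow> rel A M' \<Longrightarrow> rel A M"
proof (induction A arbitrary: M M')
  case (Atom a)
  then show ?case by (simp add: converse_rtranclp_into_rtranclp)
next
  case (Fun A B)
  then show ?case by (meson red_AppL rel.simps(2))
qed

lemma rel_expands: "M \<rightarrow>\<^sub>m\<^sup>* M' \<Longrightarrow> rel A M' \<Longrightarrow> rel A M"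
  by (induction rule: converse_rtranclp_induct) (auto intro: rel_expand)

lemma reds_VerA: "M \<rightarrow>\<^sub>m\<^sup>* M' \<Longrightarrow> VerA a M \<rightarrow>\<^sub>m\<^sup>* VerA a M'"
  by (induction rule: rtranclp_induct) (auto intro: red_VerA rtranclp.rtrancl_into_rtrancl)

lemma reds_GuardL: "M \<rightarrow>\<^sub>m\<^sup>* M' \<Longrightarrow> Guard M N \<rightarrow>\<^sub>m\<^sup>* Guard M' N"
  by (induction rule: rtranclp_induct) (auto intro: red_GuardL rtranclp.rtrancl_into_rtrancl)

lemma gen_MApp_red: "MApp (gen (A \<rightarrow>\<^sub>t B)) N \<rightarrow>\<^sub>m Guard (ver A N) (gen B)"
  using red_beta[of "Guard (ver A (MVar 0)) (gen B)" N]
  by (simp add: subst0_def msubst_gen msubst_ver)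

text \<open>The halves feed each other at \<open>A \<rightarrow>\<^sub>t B\<close>: the generator
  needs \<open>ver A\<close> to open its guard and expose \<open>gen B\<close>, while the verifier
  needs \<open>gen A\<close> as a related argument before \<open>ver B\<close> can succeed.\<close>

lemma rel_gen_ver: "rel A (gen A) \<and> (\<forall>M. rel A M \<longrightarrow> ver A M \<rightarrow>\<^sub>m\<^sup>* Star)"
proof (induction A)
  case (Atom a)
  then show ?case
    by (auto dest: reds_VerA intro: red_ver rtranclp.rtrancl_into_rtrancl)
next
  case (Fun A B)
  have "rel B (MApp (gen (A \<rightarrow>\<^sub>t B)) N)" if "rel A N" for N
  proof -
    have "Guard (ver A N) (gen B) \<rightarrow>\<^sub>m\<^sup>* Guard Star (gen B)"
      using Fun.IH(1) that by (simp add: reds_GuardL)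
    then have "rel B (Guard (ver A N) (gen B))"
      using Fun.IH(2) by (meson red_guard rel_expand rel_expands)
    then show ?thesis
      using gen_MApp_red rel_expand by blast
  qed
  then show ?case using Fun.IH by simp
qed

text \<open>Arbitrary related substitutions, not just generators, are needed because under an
  abstraction the new variable stands for any related argument.\<close>

lemma rel_msubst:
  assumes "\<Gamma> \<turnstile> t : A" and "\<And>i B. \<Gamma> i = Some B \<Longrightarrow> rel B (\<sigma> i)"
  shows "rel A (msubst \<sigma> (meta t))"
  using assms
proof (induction arbitrary: \<sigma> rule: typing.induct)
  case (ty_Lam A \<Gamma> t B)
  have "rel B (MApp (MLam (msubst (up \<sigma>) (meta t))) N)" if "rel A N" for N
  proof -
    have "rel B (msubst (case_nat N \<sigma>) (meta t))"
      \<comment> \<open>\<open>case_nat N \<sigma>\<close> is related to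
        \<open>ext A \<Gamma>\<close>: index 0 uses \<open>rel A N\<close>, the others the
        assumption on \<open>\<sigma>\<close>.\<close>
      using ty_Lam.prems that by (intro ty_Lam.IH) (auto simp: ext_def split: nat.splits)
    then show ?thesis
      by (metis red_beta rel_expand subst0_msubst_up)
  qed
  then show ?case by simp
qed auto

theorem theorem3p11:
  fixes \<Gamma> :: env and t :: trm and A :: ty
  assumes "finite (dom \<Gamma>)"
    and "\<Gamma> \<turnstile> t : A"
  shows "ver A (env_inst (meta t) \<Gamma>) \<rightarrow>\<^sub>m\<^sup>* Star"
proof -
  have "rel A (env_inst (meta t) \<Gamma>)"
    unfolding env_inst_def using assms(2) by (rule rel_msubst) (simp add: rel_gen_ver)
  then show ?thesis using rel_gen_ver by blast
qed

end
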